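(* Let $w$ be a Dyck word in the alphabet $\{V,U\}$, where $U,V$ are subject to the relation $UV=VU+V$, and let $n=|w|/2$. Then for every $k$ with $0\le k\le n$, $$\begin{bmatrix} w\\ k\end{bmatrix}=c(H^d_w,k)=c(G^d_w,k).$$
   Context: Dyck words: a word $w$ in $\{V,U\}$ is a Dyck word if it has as many $V$'s as $U$'s and every prefix contains at least as many $V$'s as $U$'s. $|w|$ is the length of $w$; put $n=|w|/2$. A Dyck word is irreducible if $w=VU$ or $w=Vw'U$ with $w'$ a non-empty Dyck word; otherwise it is reducible. Normal order coefficients: in the associative unital algebra generated by $U,V$ with the relation $UV=VU+V$, a word $w$ with $m$ $V$'s and $n$ $U$'s has a unique expansion $w=V^m\sum_{k=0}^n \begin{bmatrix} w\\ k\end{bmatrix}U^k$; this defines $\begin{bmatrix} w\\ k\end{bmatrix}$. Board $B(w)$: draw in the $n\times n$ lattice a path from the lower left corner, reading $w$ from left to right, with $V$ a unit up step and $U$ a unit right step. $B(w)$ is the set of cells lying above the path. Columns are labeled $1,\dots,n$ from right to left, rows $1,\dots,n$ from top to bottom, and $(i,j)$ is the cell in column $i$ and row $j$. (Thus column $i$ of $B(w)$ consists of the cells $(i,1),\dots,(i,b_i)$, where $b_i$ is the number of $V$'s to the right of the $i$-th $U$ from the right in $w$.) Graph $H_w$: vertex set $\{1,\dots,n\}$; for $i>j$ there is an edge between $i$ and $j$ if and only if $(i,j)\notin B(w)$. Graph $G_w$: built recursively. If $w=VU$, $G_w$ is a single vertex. If $w=Vw'U$ with $w'$ a non-empty Dyck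 word, $G_w$ is $G_{w'}$ with one added vertex adjacent to all others, corresponding to the outer pair $V,U$. If $w=w_1\cdots w_m$ is reducible with each $w_i$ irreducible, $G_w$ is the disjoint union of the $G_{w_i}$. Each $U$ of $w$ thus corresponds to a vertex of $G_w$; number the $U$'s in $w$ by $1,\dots,n$ from right to left and label each vertex by the number of its $U$. $H^d_w$ and $G^d_w$ are the labeled digraphs obtained from $H_w$ and $G_w$ by replacing each edge between $i$ and $j$, $i<j$, by a directed edge from $j$ to $i$. Cyclic partitions: for a permutation $\sigma$ of $\{1,\dots,n\}$, $\sigma^{(i)}$ is the permutation of $\{1,\dots,i\}$ obtained by keeping only the elements $j\le i$ in the cycle structure of $\sigma$. A $k$-cyclic partition of a digraph $G$ with $V(G)=\{1,\dots,n\}$ is a permutation $\sigma$ of $V(G)$ with exactly $k$ cycles (fixed points count as cycles) such that for every vertex $i$, $\sigma^{(i)}(i)=j$ only if there is no directed edge from $i$ to $j$. $c(G,k)$ is the number of $k$-cyclic partitions of $G$. *)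

theory Defs
  imports "HOL-Library.Poly_Mapping" "HOL-Combinatorics.Orbits"
begin

section \<open>Dyck words\<close>

datatype letter = V | U

definition dyck :: "letter list \<Rightarrow> bool" where
  "dyck w \<longleftrightarrow> count_list w V = count_list w U \<and>
     (\<forall>p\<le>length w. count_list (take p w) U \<le> count_list (take p w) V)"

definition irreducible_dyck :: "letter list \<Rightarrow> bool" where
  "irreducible_dyck w \<longleftrightarrow> w = [V, U] \<or> (\<exists>w'. w' \<noteq> [] \<and> dyck w' \<and> w = V # w' @ [U])"

definition semilength :: "letter list \<Rightarrow> nat" where
  "semilength w = length w div 2"


section \<open>The algebra with relation UV = VU + V and normal order coefficients\<close>

text \<open>Words form a monoid under concatenation, written additively because the convolution
  product on \<^typ>\<open>'m \<Rightarrow>\<^sub>0 'a\<close> is defined over additive monoids of exponents. The type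
  \<open>letter list \<Rightarrow>\<^sub>0 'a\<close> is then the free associative unital algebra on V and U.\<close>

instantiation list :: (type) monoid_add
begin

definition zero_list :: "'a list" where "zero_list = []"

definition plus_list :: "'a list \<Rightarrow> 'a list \<Rightarrow> 'a list" where "plus_list = (@)"

instance
  by standard (simp_all add: zero_list_def plus_list_def)

end

type_synonym 'a free_alg = "letter list \<Rightarrow>\<^sub>0 'a"

definition word_elem :: "letter list \<Rightarrow> 'a::comm_ring_1 free_alg" where
  "word_elem w = Poly_Mapping.single w 1"

definition scalar :: "'a::comm_ring_1 \<Rightarrow> 'a free_alg" where
  "scalar a = Poly_Mapping.single [] a"

abbreviation gen_V :: "'a::comm_ring_1 free_alg" where
  "gen_V \<equiv> word_elem [V]"

abbreviation gen_U :: "'a::comm_ring_1 free_alg" where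
  "gen_U \<equiv> word_elem [U]"

text \<open>The two-sided ideal generated by the relation. It is closed under negation because
  the factor \<open>a\<close> is arbitrary.\<close>

inductive_set relation_ideal :: "'a::comm_ring_1 free_alg set" where
  zero: "0 \<in> relation_ideal"
| add_gen: "x \<in> relation_ideal \<Longrightarrow>
    x + a * (gen_U * gen_V - (gen_V * gen_U + gen_V)) * b \<in> relation_ideal"

text \<open>Equality in the quotient of the free algebra by that ideal.\<close>

definition alg_eq :: "'a::comm_ring_1 free_alg \<Rightarrow> 'a free_alg \<Rightarrow> bool" where
  "alg_eq x y \<longleftrightarrow> x - y \<in> relation_ideal"

text \<open>Coefficients beyond the number of U's are set to zero, so that the coefficient
  sequence of a word is unique as a function on all naturals.\<close>

definition normal_expansion :: "letter list \<Rightarrow> (nat \<Rightarrow> 'a::comm_ring_1) \<Rightarrow> bool" where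
  "normal_expansion w c \<longleftrightarrow>
     (\<forall>k>count_list w U. c k = 0) \<and>
     alg_eq (word_elem w)
       (gen_V ^ count_list w V * (\<Sum>k=0..count_list w U. scalar (c k) * gen_U ^ k))"

definition normal_coeff :: "letter list \<Rightarrow> nat \<Rightarrow> 'a::comm_ring_1" where
  "normal_coeff w = (THE c. normal_expansion w c)"


section \<open>Graphs and digraphs\<close>

text \<open>Vertex set and edges; an undirected edge is a two-element set, a directed edge from
  \<open>i\<close> to \<open>j\<close> is the pair \<open>(i, j)\<close>.\<close>

type_synonym ugraph = "nat set \<times> nat set set"
type_synonym digraph = "nat set \<times> (nat \<times> nat) set"

definition map_graph :: "(nat \<Rightarrow> nat) \<Rightarrow> ugraph \<Rightarrow> ugraph" where
  "map_graph f G = (f ` fst G, (\<lambda>e. f ` e) ` snd G)"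

definition orient :: "ugraph \<Rightarrow> digraph" where
  "orient G = (fst G, {(j, i) | i j. i < j \<and> {i, j} \<in> snd G})"


section \<open>The board and the graph H\<close>

text \<open>The U at position \<open>p\<close> is the horizontal step of the path from \<open>(x, h)\<close> to \<open>(x + 1, h)\<close>,
  where \<open>x\<close> and \<open>h\<close> are the numbers of U's and V's before it. The cell with lower left corner
  \<open>(x, y)\<close> lies above the path iff \<open>h \<le> y\<close>. It has column label \<open>n - x\<close> (right to left) and row
  label \<open>n - y\<close> (top to bottom).\<close>

definition board :: "letter list \<Rightarrow> (nat \<times> nat) set" where
  "board w = {(semilength w - x, semilength w - y) | x y p.
     p < length w \<and> w ! p = U \<and> x = count_list (take p w) U \<and>
     count_list (take p w) V \<le> y \<and> y < semilength w}"

definition graph_H :: "letter list \<Rightarrow> ugraph" where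
  "graph_H w = ({1..semilength w},
     {{i, j} | i j. i \<in> {1..semilength w} \<and> j \<in> {1..semilength w} \<and> j < i \<and> (i, j) \<notin> board w})"


section \<open>The graph G\<close>

text \<open>The recursive construction, with each vertex being the position in the word (counted from
  0) of its U. Adding an outer pair shifts positions by one, and the factor \<open>ws ! i\<close> of a
  concatenation is shifted by the total length of the preceding factors. The last rule with
  \<open>ws = []\<close> gives the empty graph for the empty word.\<close>

inductive builds_G :: "letter list \<Rightarrow> ugraph \<Rightarrow> bool" where
  single: "builds_G [V, U] ({1}, {})"
| nest: "w' \<noteq> [] \<Longrightarrow> dyck w' \<Longrightarrow> builds_G w' G' \<Longrightarrow> G'' = map_graph Suc G' \<Longrightarrow>
    builds_G (V # w' @ [U])
      (insert (length w' + 1) (fst G''),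
       snd G'' \<union> {{x, length w' + 1} | x. x \<in> fst G''})"
| union: "\<not> irreducible_dyck (concat ws) \<Longrightarrow> length Gs = length ws \<Longrightarrow>
    (\<And>i. i < length ws \<Longrightarrow> irreducible_dyck (ws ! i)) \<Longrightarrow>
    (\<And>i. i < length ws \<Longrightarrow> builds_G (ws ! i) (Gs ! i)) \<Longrightarrow>
    (\<And>i. shifted i = map_graph (\<lambda>p. length (concat (take i ws)) + p) (Gs ! i)) \<Longrightarrow>
    builds_G (concat ws)
      (\<Union>i<length ws. fst (shifted i), \<Union>i<length ws. snd (shifted i))"

text \<open>The U's are numbered from right to left, starting with 1.\<close>

definition U_number :: "letter list \<Rightarrow> nat \<Rightarrow> nat" where
  "U_number w p = count_list (drop p w) U"

definition graph_G :: "letter list \<Rightarrow> ugraph" where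
  "graph_G w = map_graph (U_number w) (THE G. builds_G w G)"

definition digraph_H :: "letter list \<Rightarrow> digraph" where
  "digraph_H w = orient (graph_H w)"

definition digraph_G :: "letter list \<Rightarrow> digraph" where
  "digraph_G w = orient (graph_G w)"


section \<open>Cyclic partitions\<close>

text \<open>Deleting the elements greater than \<open>i\<close> from the cycles of \<open>\<sigma>\<close> sends \<open>x \<le> i\<close> to the first
  of \<open>\<sigma> x, \<sigma> (\<sigma> x), \<dots>\<close> that is at most \<open>i\<close>.\<close>

definition keep_upto :: "(nat \<Rightarrow> nat) \<Rightarrow> nat \<Rightarrow> nat \<Rightarrow> nat" where
  "keep_upto \<sigma> i x =
     (if x \<le> i then (\<sigma> ^^ (LEAST m. 0 < m \<and> (\<sigma> ^^ m) x \<le> i)) x else x)"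

text \<open>The cycles are the orbits on the vertex set, which include the fixed points.\<close>

definition cyclic_partition :: "digraph \<Rightarrow> nat \<Rightarrow> (nat \<Rightarrow> nat) \<Rightarrow> bool" where
  "cyclic_partition G k \<sigma> \<longleftrightarrow>
     \<sigma> permutes fst G \<and> card (orbit \<sigma> ` fst G) = k \<and>
     (\<forall>i\<in>fst G. \<forall>j. keep_upto \<sigma> i i = j \<longrightarrow> (i, j) \<notin> snd G)"

definition num_cyclic_partitions :: "digraph \<Rightarrow> nat \<Rightarrow> nat" where
  "num_cyclic_partitions G k = card {\<sigma>. cyclic_partition G k \<sigma>}"

end

theory Submission
  imports Defs "HOL-Computational_Algebra.Polynomial"
begin

text \<open>Let \<open>b\<^sub>i\<close> be the number of \<open>V\<close>'s to the right of the \<open>i\<close>-th \<open>U\<close> from the right. Moving \<open>V\<close>'s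
  to the left with \<open>U V\<^sup>m = V\<^sup>m (U + m)\<close> gives \<open>w = V\<^sup>n \<Prod>\<^sub>i (U + b\<^sub>i)\<close>. On the other side, cyclic
  partitions of a digraph all of whose edges decrease the label are built by inserting
  \<open>1, 2, \<dots>, n\<close> successively into the cycles. A vertex \<open>i\<close> that has \<open>d\<^sub>i\<close> outgoing edges can form a new
  cycle or precede one of \<open>i - 1 - d\<^sub>i\<close> smaller vertices, so the generating polynomial is
  \<open>\<Prod>\<^sub>i (x + i - 1 - d\<^sub>i)\<close>. It remains to see that \<open>i - 1 - d\<^sub>i = b\<^sub>i\<close> for both digraphs. For \<open>H\<close> this
  is the definition of the board. For \<open>G\<close>, \<open>d\<^sub>i\<close> is the number of pairs enclosing the \<open>i\<close>-th \<open>U\<close>, which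
  is the height of the path after this \<open>U\<close>, namely \<open>(i - 1) - b\<^sub>i\<close>.\<close>

section \<open>Normal order coefficients\<close>

lemma poly_mapping_single_induct [case_names zero add]:
  assumes "P 0" and "\<And>x v a. P x \<Longrightarrow> P (x + Poly_Mapping.single v a)"
  shows "P x"
proof (induction x rule: update_induct)
  case const
  then show ?case by (rule assms(1))
next
  case (update f v a)
  have "Poly_Mapping.update v a f = f + Poly_Mapping.single v a"
    using update(1)
    by (intro poly_mapping_eqI)
       (auto simp: lookup_update lookup_add lookup_single when_def in_keys_iff)
  then show ?case using assms(2) update by simp
qed

lemma single_Nil: "Poly_Mapping.single [] 1 = 1"
  by (simp flip: zero_list_def)

lemma single_word_mult:
  "Poly_Mapping.single u a * Poly_Mapping.single v b = Poly_Mapping.single (u @ v) (a * b)"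
  by (simp add: mult_single plus_list_def)

text \<open>Each \<open>U\<close> contributes \<open>x + b\<close>, where \<open>b\<close> counts
  the \<open>V\<close>'s to its right: this is what becomes of that \<open>U\<close> once those
  \<open>V\<close>'s have been moved in front of it.\<close>

fun normal_poly :: "letter list \<Rightarrow> 'a::comm_semiring_1 poly" where
  "normal_poly [] = 1"
| "normal_poly (V # w) = normal_poly w"
| "normal_poly (U # w) = [:of_nat (count_list w V), 1:] * normal_poly w"

lemma degree_normal_poly: "degree (normal_poly w :: 'a::comm_ring_1 poly) \<le> count_list w U"
proof (induction w rule: normal_poly.induct)
  case (3 w)
  have "degree ([:of_nat (count_list w V), 1:] * normal_poly w :: 'a poly) \<le> 1 + count_list w U"
    by (rule order.trans[OF degree_mult_le add_mono]) (use 3 in auto)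
  then show ?case by simp
qed auto

text \<open>The three words after \<open>u\<close> have the same number of \<open>V\<close>'s, so
  the letters of \<open>u\<close> contribute equal factors. What remains is
  \<open>x + (b + 1) = (x + b) + 1\<close>, with \<open>b\<close> the number of \<open>V\<close>'s
  in \<open>v\<close>.\<close>

lemma normal_poly_relation:
  "normal_poly (u @ [U, V] @ v) =
     (normal_poly (u @ [V, U] @ v) + normal_poly (u @ V # v) :: 'a::comm_semiring_1 poly)"
proof (induction u rule: normal_poly.induct)
  case 1
  then show ?case by (simp add: smult_add_left algebra_simps)
next
  case (3 u)
  then show ?case by (simp add: distrib_left del: mult_pCons_left)
qed simp

lemma normal_poly_V_power [simp]:
  "normal_poly (replicate m V @ v) = (normal_poly v :: 'a::comm_semiring_1 poly)"
  by (induction m) auto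

lemma normal_poly_U_power [simp]:
  "normal_poly (replicate k U) = (monom 1 k :: 'a::comm_semiring_1 poly)"
proof (induction k)
  case (Suc k)
  have "count_list (replicate k U) V = 0"
    by (induction k) auto
  then show ?case using Suc by (simp add: monom_Suc)
qed simp

text \<open>The action on the component \<open>V\<^sup>m\<close> of the module with basis \<open>V\<^sup>m U\<^sup>k\<close>. Since \<open>U\<close> sends
  \<open>V\<^sup>m p(U)\<close> to \<open>V\<^sup>m (U + m) p(U)\<close>, this is faithful on normal forms in every characteristic,
  unlike the action by differential operators.\<close>

definition normal_form :: "nat \<Rightarrow> 'a::comm_ring_1 free_alg \<Rightarrow> 'a poly" where
  "normal_form m x = Sum_any (\<lambda>v. if count_list v V = m
     then smult (Poly_Mapping.lookup x v) (normal_poly v) else 0)"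

lemma normal_form_add: "normal_form m (x + y) = normal_form m x + normal_form m y"
proof -
  let ?f = "\<lambda>x v. if count_list v V = m
     then smult (Poly_Mapping.lookup x v) (normal_poly v :: 'a poly) else 0"
  have fin: "finite {v. ?f x v \<noteq> 0}" for x
    by (rule finite_subset[OF _ finite_lookup[of x]]) auto
  have "?f (x + y) = (\<lambda>v. ?f x v + ?f y v)"
    by (auto simp: fun_eq_iff lookup_add smult_add_left)
  then show ?thesis
    unfolding normal_form_def using Sum_any.distrib[OF fin fin, of x y] by (simp only:)
qed

lemma normal_form_zero [simp]: "normal_form m 0 = 0"
  by (simp add: normal_form_def cong: if_cong)

lemma normal_form_uminus: "normal_form m (- x) = - normal_form m x"
  using normal_form_add[of m x "- x"] by (simp add: eq_neg_iff_add_eq_0 add.commute)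

lemma normal_form_diff: "normal_form m (x - y) = normal_form m x - normal_form m y"
  using normal_form_add[of m x "- y"] by (simp add: normal_form_uminus)

lemma normal_form_sum: "normal_form m (sum f A) = (\<Sum>i\<in>A. normal_form m (f i))"
  by (induction A rule: infinite_finite_induct) (auto simp: normal_form_add)

lemma normal_form_single:
  "normal_form m (Poly_Mapping.single v a) =
     (if count_list v V = m then smult a (normal_poly v) else 0)"
  unfolding normal_form_def
  by (subst Sum_any.expand_superset[of "{v}"]) (auto simp: lookup_single when_def)

text \<open>By additivity, both outer factors may be taken to be single words with coefficients, and
  there the claim is \<open>normal_poly_relation\<close>.\<close>

lemma normal_form_relation:
  "normal_form m (a * (gen_U * gen_V - (gen_V * gen_U + gen_V)) * b) = 0"
proof -
  let ?r = "gen_U * gen_V - (gen_V * gen_U + gen_V) :: 'a free_alg"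
  have word: "normal_form m (Poly_Mapping.single u a * ?r * Poly_Mapping.single v b) = 0"
    for u v and a b :: 'a
    using normal_poly_relation[of u v, where 'a = 'a]
    by (simp add: word_elem_def algebra_simps single_word_mult normal_form_diff normal_form_add
        normal_form_single smult_add_right)
  have "normal_form m (Poly_Mapping.single u c * ?r * b) = 0" for u c
    by (induction b rule: poly_mapping_single_induct)
       (simp_all add: word distrib_left normal_form_add del: mult.assoc)
  then show ?thesis
    by (induction a rule: poly_mapping_single_induct)
       (simp_all add: distrib_right normal_form_add)
qed

lemma normal_form_ideal: "x \<in> relation_ideal \<Longrightarrow> normal_form m x = 0"
  by (induction rule: relation_ideal.induct) (auto simp: normal_form_add normal_form_relation)

lemma normal_form_cong: "alg_eq x y \<Longrightarrow> normal_form m x = normal_form m y"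
  using normal_form_ideal[of "x - y" m] by (simp add: alg_eq_def normal_form_diff)

lemma word_elem_power: "word_elem [l] ^ k = word_elem (replicate k l)"
  by (induction k) (simp_all add: word_elem_def single_word_mult flip: single_Nil)

text \<open>With \<open>m\<close> the number of \<open>V\<close>'s in \<open>w\<close>,
  \<open>normal_form m\<close> respects the relation and sends \<open>V^m U^k\<close> to
  \<open>x^k\<close>, so it reads the coefficients off the expansion.\<close>

lemma normal_expansion_unique:
  assumes "normal_expansion w (c :: nat \<Rightarrow> 'a::comm_ring_1)"
  shows "c = coeff (normal_poly w)"
proof -
  let ?m = "count_list w V" and ?n = "count_list w U"
  have V: "count_list (replicate ?m V @ replicate k U) V = ?m" for k
  proof -
    have "count_list (replicate k U) V = 0" by (induction k) auto
    moreover have "count_list (replicate m V) V = m" for m by (induction m) auto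
    ultimately show ?thesis by (simp only: count_list_append add_0_right)
  qed
  have "normal_poly w = normal_form ?m (word_elem w :: 'a free_alg)"
    by (simp add: word_elem_def normal_form_single)
  also have "\<dots> = normal_form ?m (gen_V ^ ?m * (\<Sum>k=0..?n. scalar (c k) * gen_U ^ k))"
    using assms by (intro normal_form_cong) (simp add: normal_expansion_def)
  also have "\<dots> = (\<Sum>k=0..?n. smult (c k) (monom 1 k))"
    by (simp only: word_elem_power sum_distrib_left normal_form_sum)
       (simp add: scalar_def word_elem_def single_word_mult normal_form_single V del: count_list_append)
  finally have eq: "normal_poly w = (\<Sum>k=0..?n. smult (c k) (monom 1 k))" .
  show ?thesis
  proof
    fix k
    show "c k = coeff (normal_poly w) k"
      using assms by (auto simp: eq coeff_sum normal_expansion_def if_distrib[of "(*) _"]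
          cong: if_cong)
  qed
qed

section \<open>Existence of the normal ordered expansion\<close>

lemma relation_ideal_add:
  "y \<in> relation_ideal \<Longrightarrow> x \<in> relation_ideal \<Longrightarrow> x + y \<in> relation_ideal"
  by (induction rule: relation_ideal.induct)
     (auto simp flip: add.assoc intro: relation_ideal.intros)

lemma relation_ideal_mult:
  "x \<in> relation_ideal \<Longrightarrow> a * x * b \<in> relation_ideal"
proof (induction rule: relation_ideal.induct)
  case (add_gen x c d)
  then show ?case
    using relation_ideal.add_gen[of "a * x * b" "a * c" "d * b"]
    by (simp only: distrib_left distrib_right mult.assoc)
qed (auto intro: relation_ideal.zero)

lemma alg_eq_refl: "alg_eq x x"
  by (simp add: alg_eq_def relation_ideal.zero)

lemma alg_eq_trans: "alg_eq x y \<Longrightarrow> alg_eq y z \<Longrightarrow> alg_eq x z"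
  using relation_ideal_add[of "x - y" "y - z"] by (simp add: alg_eq_def add.commute)

lemma alg_eq_add: "alg_eq x y \<Longrightarrow> alg_eq x' y' \<Longrightarrow> alg_eq (x + x') (y + y')"
  using relation_ideal_add[of "x - y" "x' - y'"] by (simp add: alg_eq_def algebra_simps)

lemma alg_eq_mult: "alg_eq x y \<Longrightarrow> alg_eq (a * x * b) (a * y * b)"
  using relation_ideal_mult[of "x - y" a b]
  by (simp add: alg_eq_def left_diff_distrib right_diff_distrib)

lemma alg_eq_commute: "alg_eq (gen_U * gen_V) (gen_V * gen_U + gen_V)"
  using relation_ideal.add_gen[OF relation_ideal.zero, of 1 1] by (simp add: alg_eq_def)

text \<open>The induction multiplies on the right by \<open>V\<close>:
  \<open>V^m (U + m) V = V^m (V U + V) + m V^(m+1)\<close>, and the extra \<open>V\<close> raises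
  \<open>m\<close> to \<open>m + 1\<close>.\<close>

lemma alg_eq_U_V_power:
  "alg_eq (gen_U * gen_V ^ m) (gen_V ^ m * (gen_U + scalar (of_nat m) :: 'a::comm_ring_1 free_alg))"
proof (induction m)
  case 0
  then show ?case by (simp add: scalar_def alg_eq_refl)
next
  case (Suc m)
  have comm: "gen_V * scalar a = scalar a * gen_V" for a :: 'a
    by (simp add: word_elem_def scalar_def single_word_mult)
  have "alg_eq (1 * (gen_U * gen_V ^ m) * gen_V)
      (1 * (gen_V ^ m * (gen_U + scalar (of_nat m))) * gen_V :: 'a free_alg)"
    by (rule alg_eq_mult[OF Suc])
  moreover have "alg_eq (gen_V ^ m * (gen_U * gen_V) * 1 + gen_V ^ m * scalar (of_nat m) * gen_V)
    (gen_V ^ m * (gen_V * gen_U + gen_V) * 1 + gen_V ^ m * scalar (of_nat m) * gen_V :: 'a free_alg)"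
    by (intro alg_eq_add alg_eq_mult alg_eq_commute alg_eq_refl)
  moreover have "gen_V ^ m * scalar (of_nat m) * gen_V = gen_V ^ m * gen_V * scalar (of_nat m :: 'a)"
    by (simp add: comm mult.assoc)
  moreover have "gen_V * gen_V ^ m = gen_V ^ m * (gen_V :: 'a free_alg)"
    by (rule power_commutes[symmetric])
  ultimately show ?case
    using alg_eq_trans
    by (simp add: scalar_def[of "1 + _"] single_add flip: scalar_def)
       (simp add: scalar_def[of 1] single_Nil distrib_left distrib_right add.assoc mult.assoc)
qed

fun normal_word :: "letter list \<Rightarrow> 'a::comm_ring_1 free_alg" where
  "normal_word [] = 1"
| "normal_word (V # w) = normal_word w"
| "normal_word (U # w) = (gen_U + scalar (of_nat (count_list w V))) * normal_word w"

lemma normal_word_eq: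
  "normal_word w = (\<Sum>k=0..count_list w U. scalar (coeff (normal_poly w) k) * gen_U ^ k
     :: 'a::comm_ring_1 free_alg)"
proof (induction w rule: normal_word.induct)
  case 1
  then show ?case by (simp add: scalar_def single_Nil)
next
  case (3 w)
  let ?n = "count_list w U" and ?b = "of_nat (count_list w V) :: 'a"
  let ?p = "normal_poly w :: 'a poly"
  let ?S = "\<Sum>k=0..?n. scalar (coeff ?p k) * gen_U ^ k :: 'a free_alg"
  have comm: "gen_U * scalar a = scalar a * gen_U" for a :: 'a
    by (simp add: word_elem_def scalar_def single_word_mult)
  have scalar_add: "scalar (a + b) = scalar a + scalar b"
    and scalar_mult: "scalar (a * b) = scalar a * scalar b" for a b :: 'a
    by (simp_all add: scalar_def single_add single_word_mult)
  \<comment> \<open>The coefficient one above the degree bound vanishes, so in the sum for the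
    scalar term the upper limit \<open>Suc ?n\<close> drops back to \<open>?n\<close>.\<close>
  have top: "coeff ?p (Suc ?n) = 0"
    using degree_normal_poly[of w, where 'a = 'a] by (intro coeff_eq_0) simp
  have "(\<Sum>k=0..Suc ?n. scalar (coeff ([:?b, 1:] * ?p) k) * gen_U ^ k)
     = (\<Sum>k=0..Suc ?n. scalar ?b * (scalar (coeff ?p k) * gen_U ^ k))
       + (\<Sum>k=0..Suc ?n. scalar (coeff (pCons 0 ?p) k) * gen_U ^ k)"
    by (simp add: scalar_add scalar_mult distrib_right mult.assoc flip: sum.distrib
        del: sum.op_ivl_Suc sum.cl_ivl_Suc)
  also have "(\<Sum>k=0..Suc ?n. scalar ?b * (scalar (coeff ?p k) * gen_U ^ k)) = scalar ?b * ?S"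
    by (simp add: top sum_distrib_left scalar_def)
  also have "(\<Sum>k=0..Suc ?n. scalar (coeff (pCons 0 ?p) k) * gen_U ^ k) = gen_U * ?S"
    by (subst sum.atLeast0_atMost_Suc_shift)
       (simp add: scalar_def[of 0] sum_distrib_left comm flip: mult.assoc)
  finally show ?case
    using 3 by (simp add: distrib_right add.commute)
qed simp

text \<open>Induction on the first letter: a leading \<open>V\<close> joins the power in front, and
  a leading \<open>U\<close> passes the power \<open>V^m\<close> of the rest and becomes
  \<open>U + m\<close>.\<close>

lemma normal_expansion_normal_poly:
  "normal_expansion w (coeff (normal_poly w :: 'a::comm_ring_1 poly))"
proof -
  have "alg_eq (word_elem w) (gen_V ^ count_list w V * normal_word w :: 'a free_alg)"
  proof (induction w rule: normal_word.induct)
    case 1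
    then show ?case
      by (simp add: word_elem_def single_Nil alg_eq_refl)
  next
    case (2 w)
    then show ?case
      using alg_eq_mult[of "word_elem w" _ gen_V 1]
      by (simp add: word_elem_def single_word_mult mult.assoc)
  next
    case (3 w)
    let ?m = "count_list w V"
    have "alg_eq (gen_U * word_elem w * 1) (gen_U * (gen_V ^ ?m * normal_word w) * 1 :: 'a free_alg)"
      by (rule alg_eq_mult[OF 3])
    moreover have "alg_eq (1 * (gen_U * gen_V ^ ?m) * normal_word w)
        (1 * (gen_V ^ ?m * (gen_U + scalar (of_nat ?m))) * normal_word w :: 'a free_alg)"
      by (intro alg_eq_mult alg_eq_U_V_power)
    ultimately show ?case
      using alg_eq_trans by (simp add: word_elem_def single_word_mult mult.assoc)
  qed
  moreover have "coeff (normal_poly w :: 'a poly) k = 0" if "k > count_list w U" for k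
    using degree_normal_poly[of w, where 'a = 'a] that by (intro coeff_eq_0) simp
  ultimately show ?thesis
    by (simp add: normal_expansion_def normal_word_eq)
qed

lemma normal_coeff_eq: "normal_coeff w = coeff (normal_poly w :: 'a::comm_ring_1 poly)"
  unfolding normal_coeff_def
  by (rule the_equality) (fact normal_expansion_normal_poly normal_expansion_unique)+

section \<open>Counting cyclic partitions\<close>

text \<open>Inductive account of the value selected by \<open>keep_upto\<close>: follow
  \<open>f\<close> from \<open>x\<close> until a value at most \<open>i\<close> appears. Rule
  induction replaces arguments about the least exponent.\<close>

inductive first_return :: "('a::linorder \<Rightarrow> 'a) \<Rightarrow> 'a \<Rightarrow> 'a \<Rightarrow> 'a \<Rightarrow> bool" for f i where
  stop: "f x \<le> i \<Longrightarrow> first_return f i x (f x)"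
| pass: "f x > i \<Longrightarrow> first_return f i (f x) y \<Longrightarrow> first_return f i x y"

lemma first_return_Least:
  "first_return f i x y \<Longrightarrow>
     (\<exists>m>0. (f ^^ m) x \<le> i) \<and> (f ^^ (LEAST m. 0 < m \<and> (f ^^ m) x \<le> i)) x = y"
proof (induction rule: first_return.induct)
  case (stop x)
  have "(LEAST m. 0 < m \<and> (f ^^ m) x \<le> i) = 1"
    using stop by (intro Least_equality) auto
  then show ?case using stop by (auto intro!: exI[of _ 1])
next
  case (pass x y)
  let ?P = "\<lambda>m. 0 < m \<and> (f ^^ m) x \<le> i"
  let ?Q = "\<lambda>m. 0 < m \<and> (f ^^ m) (f x) \<le> i"
  from pass obtain m where m: "?Q m" by blast
  \<comment> \<open>For \<open>m = 0\<close> both sides fail, the left one because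
    \<open>f x > i\<close>, so the least exponent moves by exactly one.\<close>
  have shift: "?P (Suc m) \<longleftrightarrow> ?Q m" for m
    using pass.hyps by (cases m) (auto simp: funpow_Suc_right simp del: funpow.simps)
  have "(LEAST m. ?P m) = Suc (LEAST m. ?P (Suc m))"
    using m by (intro Least_Suc[of _ "Suc m"]) (use shift in blast, simp)
  also have "\<dots> = Suc (LEAST m. ?Q m)"
    by (simp only: shift)
  finally show ?case
    using pass.IH m shift[of m] by (auto simp: funpow_Suc_right simp del: funpow.simps)
qed

lemma first_return_keep_upto:
  "first_return f i x y \<Longrightarrow> x \<le> i \<Longrightarrow> keep_upto f i x = y"
  using first_return_Least[of f i x y] by (simp add: keep_upto_def)

lemma first_return_exists:
  "0 < m \<Longrightarrow> (f ^^ m) x \<le> i \<Longrightarrow> \<exists>y. first_return f i x y"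
proof (induction m arbitrary: x)
  case (Suc m)
  show ?case
  proof (cases "f x \<le> i")
    case True
    then show ?thesis by (blast intro: first_return.stop)
  next
    case False
    then have "m > 0" using Suc.prems by (cases m) auto
    then show ?thesis
      using Suc False by (auto simp: funpow_swap1 not_le intro: first_return.pass)
  qed
qed simp

section \<open>Inserting an element into a cycle of a permutation\<close>

context
  fixes f g :: "'a \<Rightarrow> 'a" and S :: "'a set" and a b :: 'a
  assumes perm: "f permutes S" and a: "a \<notin> S" and g: "g = transpose a b \<circ> f"
begin

lemma f_eq_a_iff: "f x = a \<longleftrightarrow> x = a"
  using permutes_not_in[OF perm a] injD[OF permutes_inj[OF perm], of x a] by auto

text \<open>As \<open>f\<close> fixes \<open>a\<close>, the composition places \<open>a\<close> just
  before \<open>b\<close> in the cycle of \<open>b\<close>; for \<open>b = a\<close> it changes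
  nothing and \<open>a\<close> stays a cycle of its own.\<close>

lemma insert_cycle_apply:
  "g a = b" "x \<noteq> a \<Longrightarrow> g x = (if f x = b then a else f x)"
  using f_eq_a_iff by (auto simp: g transpose_def)

text \<open>A step of \<open>f\<close> is one step of \<open>g\<close>, or two steps through
  \<open>a\<close> when it arrives at \<open>b\<close>.\<close>

lemma orbit_imp_orbit_insert:
  "y \<in> orbit f x \<Longrightarrow> x \<noteq> a \<Longrightarrow> y \<in> orbit g x \<and> y \<noteq> a"
proof (induction rule: orbit.induct)
  case base
  have "f x \<in> orbit g x"
  proof (cases "f x = b")
    case True
    then have "a \<in> orbit g x" using insert_cycle_apply(2)[OF base] orbit.base[of g x] by simp
    from orbit.step[OF this] show ?thesis using insert_cycle_apply(1) True by simp
  next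
    case False
    then show ?thesis using insert_cycle_apply(2)[OF base] orbit.base[of g x] by simp
  qed
  then show ?case using base f_eq_a_iff by simp
next
  case (step y)
  then have y: "y \<in> orbit g x" "y \<noteq> a" by auto
  have "f y \<in> orbit g x"
  proof (cases "f y = b")
    case True
    then have "a \<in> orbit g x" using insert_cycle_apply(2)[OF y(2)] orbit.step[OF y(1)] by simp
    from orbit.step[OF this] show ?thesis using insert_cycle_apply(1) True by simp
  next
    case False
    then show ?thesis using insert_cycle_apply(2)[OF y(2)] orbit.step[OF y(1)] by simp
  qed
  then show ?case using y f_eq_a_iff by simp
qed

text \<open>A visit of \<open>g\<close> to \<open>a\<close> stands for the arrival of
  \<open>f\<close> at \<open>b\<close>, which is where \<open>g\<close> goes next.\<close>

lemma orbit_insert_imp_orbit: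
  "y \<in> orbit g x \<Longrightarrow> x \<noteq> a \<Longrightarrow> (if y = a then b else y) \<in> orbit f x"
proof (induction rule: orbit.induct)
  case base
  then show ?case
    using insert_cycle_apply(2)[OF base] orbit.base[of f x] f_eq_a_iff[of x] by (auto split: if_splits)
next
  case (step y)
  then show ?case
    using insert_cycle_apply(1) insert_cycle_apply(2)[of y] orbit.step[of y f x] f_eq_a_iff[of y]
    by (cases "y = a") (auto split: if_splits)
qed

text \<open>The new element joins the orbit of \<open>b\<close>, and deleting it turns the orbits of
  \<open>g\<close> bijectively into those of \<open>f\<close>.\<close>

lemma card_orbits_insert:
  assumes "finite S" "b \<in> S"
  shows "card (orbit g ` insert a S) = card (orbit f ` S)"
proof -
  have "f permutes insert a S" using perm by (rule permutes_subset) auto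
  then have "g permutes insert a S"
    unfolding g using assms by (intro permutes_compose permutes_swap_id) auto
  then have pg: "permutation g" using assms(1) by (auto simp: permutation_permutes)
  have pf: "permutation f" using assms(1) perm by (auto simp: permutation_permutes)
  have "orbit g a = orbit g b"
    using permutation_orbit_step[OF pg, of a] insert_cycle_apply(1) by simp
  then have "orbit g ` insert a S = orbit g ` S" using assms(2) by auto
  moreover have "card (orbit g ` S) = card (orbit f ` S)"
  proof (rule bij_betw_same_card)
    have eq: "orbit g x - {a} = orbit f x" if "x \<in> S" for x
    proof -
      have "x \<noteq> a" using that a by auto
      then show ?thesis
        using orbit_imp_orbit_insert[of _ x] orbit_insert_imp_orbit[of _ x]
        by (intro set_eqI) (metis Diff_iff singletonD singletonI)
    qed
    \<comment> \<open>Injectivity of the deletion: orbits that agree off \<open>a\<close> contain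
      each other's base points, because these lie in a common orbit of \<open>f\<close>.\<close>
    have same: "orbit g x = orbit g y" if "x \<in> S" "y \<in> S" "orbit g x - {a} = orbit g y - {a}" for x y
    proof -
      have "orbit f x = orbit f y" using eq[OF that(1)] eq[OF that(2)] that(3) by simp
      then have "x \<in> orbit f y" "y \<in> orbit f x"
        using permutation_self_in_orbit[OF pf, of x] permutation_self_in_orbit[OF pf, of y]
        by simp_all
      moreover have "x \<noteq> a" "y \<noteq> a" using that a by auto
      ultimately have "x \<in> orbit g y" "y \<in> orbit g x"
        using orbit_imp_orbit_insert by simp_all
      then show ?thesis by (intro equalityI subsetI) (erule orbit_trans, assumption)+
    qed
    have "inj_on (\<lambda>X. X - {a}) (orbit g ` S)"
    proof (rule inj_onI)
      fix X Y assume "X \<in> orbit g ` S" "Y \<in> orbit g ` S" and XY: "X - {a} = Y - {a}"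
      then obtain x y where "x \<in> S" "X = orbit g x" "y \<in> S" "Y = orbit g y" by blast
      then show "X = Y" using same[of x y] XY by blast
    qed
    moreover have "(\<lambda>X. X - {a}) ` orbit g ` S = orbit f ` S"
      unfolding image_image by (rule image_cong[OF refl eq])
    ultimately show "bij_betw (\<lambda>X. X - {a}) (orbit g ` S) (orbit f ` S)"
      by (simp only: bij_betw_def)
  qed
  ultimately show ?thesis by simp
qed

text \<open>Stated for \<open>f\<close> itself, because inserting \<open>a\<close> as a new cycle is
  the case \<open>b = a\<close>, where \<open>g = f\<close>. The extra orbit is
  \<open>{a}\<close>.\<close>

lemma card_orbits_insert_fixed:
  assumes "finite S"
  shows "card (orbit f ` insert a S) = Suc (card (orbit f ` S))"
proof -
  have "f a = a" using f_eq_a_iff by simp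
  then have "orbit f a = {a}" by (simp add: orbit_eq_singleton_iff)
  moreover have "a \<notin> orbit f x" if "x \<in> S" for x
    using permutes_orbit_subset[OF perm that] a by auto
  ultimately show ?thesis using assms by (subst image_insert) (subst card_insert_disjoint, auto)
qed

end

text \<open>Since \<open>a\<close> exceeds \<open>i\<close>, an excursion through \<open>a\<close>
  is only one more passing step and cannot end the search.\<close>

lemma first_return_insert:
  fixes f :: "'a::linorder \<Rightarrow> 'a"
  assumes "f permutes S" "a \<notin> S" "g = transpose a b \<circ> f" "i < a"
  shows "first_return f i x y \<Longrightarrow> x \<noteq> a \<Longrightarrow> first_return g i x y"
proof (induction rule: first_return.induct)
  note g = insert_cycle_apply[OF assms(1-3)]
  {
    case (stop x)
    show ?case
    proof (cases "f x = b")
      case True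
      then have "g x = a" "g a = f x" using g stop by auto
      then show ?thesis
        using stop assms(4) first_return.stop[of g a i] first_return.pass[of i g x "f x"] by simp
    next
      case False
      then have "g x = f x" using g stop by auto
      then show ?thesis using stop first_return.stop[of g x i] by simp
    qed
  next
    case (pass x y)
    then have IH: "first_return g i (f x) y" using f_eq_a_iff[OF assms(1,2)] by simp
    show ?case
    proof (cases "f x = b")
      case True
      then have "g x = a" "g a = f x" using g pass by auto
      then show ?thesis
        using pass IH assms(4) first_return.pass[of i g a y] first_return.pass[of i g x y] by simp
    next
      case False
      then have "g x = f x" using g pass by auto
      then show ?thesis using pass IH first_return.pass[of i g x y] by simp
    qed
  }
qed

lemma keep_upto_insert:
  assumes "f permutes S" "finite S" "a \<notin> S" "i < a"
  shows "keep_upto (transpose a b \<circ> f) i i = keep_upto f i i"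
proof -
  have "permutation f" using assms by (auto simp: permutation_permutes)
  then have "i \<in> orbit f i" by (rule permutation_self_in_orbit)
  then obtain m where "0 < m" "(f ^^ m) i \<le> i" by (auto simp: orbit_altdef)
  then obtain y where "first_return f i i y" using first_return_exists by blast
  then show ?thesis
    using first_return_insert[OF assms(1,3) refl assms(4), of i y] assms(4)
    by (simp add: first_return_keep_upto)
qed

lemma keep_upto_eq_apply:
  assumes "f i \<le> i"
  shows "keep_upto f i i = f i"
  using assms by (intro first_return_keep_upto first_return.stop) auto

text \<open>Inserting \<open>n + 1\<close> into the cycles of a permutation of \<open>{1..n}\<close>, either as a new cycle or
  just before an admissible \<open>j \<le> n\<close>.\<close>

lemma cyclic_partition_Suc:
  assumes E: "\<And>i j. (i, j) \<in> E \<Longrightarrow> j < i"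
  defines "C \<equiv> \<lambda>n k. {\<sigma>. cyclic_partition ({1..n}, E) k \<sigma>}"
  shows "C (Suc n) k = (\<lambda>(j, \<sigma>). transpose (Suc n) j \<circ> \<sigma>) `
     ({Suc n} \<times> (if k = 0 then {} else C n (k - 1)) \<union> {j \<in> {1..<Suc n}. (Suc n, j) \<notin> E} \<times> C n k)"
    (is "_ = ?ins ` ?R")
proof -
  have interval: "{1..Suc n} = insert (Suc n) {1..n}" by auto
  have iff: "cyclic_partition ({1..Suc n}, E) k (transpose (Suc n) j \<circ> \<sigma>) \<longleftrightarrow> (j, \<sigma>) \<in> ?R"
    if \<sigma>: "\<sigma> permutes {1..n}" and j: "j \<in> {1..Suc n}" for j \<sigma>
  proof -
    let ?\<tau> = "transpose (Suc n) j \<circ> \<sigma>"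
    have \<tau>: "?\<tau> permutes {1..Suc n}"
      using \<sigma> j by (intro permutes_compose permutes_swap_id permutes_subset[OF \<sigma>]) auto
    have keep: "keep_upto ?\<tau> i i = keep_upto \<sigma> i i" if "i \<in> {1..n}" for i
      using that by (intro keep_upto_insert[OF \<sigma>]) auto
    have "?\<tau> (Suc n) = j" using insert_cycle_apply(1)[OF \<sigma> _ refl, of "Suc n" j] by simp
    then have keep_j: "keep_upto ?\<tau> (Suc n) (Suc n) = j"
      using keep_upto_eq_apply[of ?\<tau> "Suc n"] j by simp
    define ok where "ok \<longleftrightarrow> (\<forall>i\<in>{1..n}. (i, keep_upto \<sigma> i i) \<notin> E)"
    have "(\<forall>i\<in>{1..Suc n}. (i, keep_upto ?\<tau> i i) \<notin> E) \<longleftrightarrow> (Suc n, j) \<notin> E \<and> ok"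
      unfolding interval ok_def ball_simps by (simp only: keep keep_j cong: ball_cong)
    then have cyc_\<tau>: "cyclic_partition ({1..Suc n}, E) k ?\<tau> \<longleftrightarrow>
        card (orbit ?\<tau> ` {1..Suc n}) = k \<and> (Suc n, j) \<notin> E \<and> ok"
      using \<tau> unfolding cyclic_partition_def fst_conv snd_conv by blast
    have cyc_\<sigma>: "\<sigma> \<in> C n m \<longleftrightarrow> card (orbit \<sigma> ` {1..n}) = m \<and> ok" for m
      using \<sigma> unfolding C_def mem_Collect_eq cyclic_partition_def fst_conv snd_conv ok_def by blast
    show ?thesis
    proof (cases "j = Suc n")
      case True
      have "card (orbit ?\<tau> ` {1..Suc n}) = Suc (card (orbit \<sigma> ` {1..n}))"
        unfolding interval True using card_orbits_insert_fixed[OF \<sigma>, of "Suc n"] by simp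
      \<comment> \<open>Edges decrease labels, so there is no loop at \<open>Suc n\<close> and a new
        cycle is always allowed.\<close>
      moreover have "(Suc n, j) \<notin> E" using E True by blast
      ultimately show ?thesis
        unfolding cyc_\<tau> using True by (cases k) (auto simp: cyc_\<sigma>)
    next
      case False
      then have "card (orbit ?\<tau> ` {1..Suc n}) = card (orbit \<sigma> ` {1..n})"
        unfolding interval using j by (intro card_orbits_insert[OF \<sigma> _ refl]) auto
      then show ?thesis
        unfolding cyc_\<tau> using False j by (auto simp: cyc_\<sigma>)
    qed
  qed
  have R: "?R \<subseteq> {(j, \<sigma>). j \<in> {1..Suc n} \<and> \<sigma> permutes {1..n}}"
    by (auto simp: C_def cyclic_partition_def split: if_splits)
  show ?thesis
  proof (intro equalityI subsetI)
    fix \<tau> assume "\<tau> \<in> C (Suc n) k"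
    then have \<tau>: "cyclic_partition ({1..Suc n}, E) k \<tau>" by (simp add: C_def)
    then have perm: "\<tau> permutes {1..Suc n}"
      by (simp only: cyclic_partition_def fst_conv)
    \<comment> \<open>The insertion is undone by reading off the image of \<open>Suc n\<close> and
      composing with the same transposition, which makes \<open>Suc n\<close> a fixed point.\<close>
    define j where "j = \<tau> (Suc n)"
    define \<sigma> where "\<sigma> = transpose (Suc n) j \<circ> \<tau>"
    have "j \<in> {1..Suc n}"
      using permutes_in_image[OF perm, of "Suc n"] by (simp add: j_def)
    moreover have "\<sigma> permutes {1..n}"
      using permutes_insert_lemma[of \<tau> "Suc n" "{1..n}"] perm by (simp only: interval \<sigma>_def j_def)
    moreover have "\<tau> = transpose (Suc n) j \<circ> \<sigma>"
      by (simp add: \<sigma>_def fun_eq_iff)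
    moreover from calculation have "(j, \<sigma>) \<in> ?R"
      using iff[of \<sigma> j] \<tau> by simp
    ultimately show "\<tau> \<in> ?ins ` ?R"
      by (intro image_eqI[of _ _ "(j, \<sigma>)"]) auto
  next
    fix \<tau> assume "\<tau> \<in> ?ins ` ?R"
    then obtain j \<sigma> where mem: "(j, \<sigma>) \<in> ?R" and \<tau>: "\<tau> = transpose (Suc n) j \<circ> \<sigma>"
      by (elim imageE) auto
    from R mem have "j \<in> {1..Suc n}" "\<sigma> permutes {1..n}" by blast+
    then show "\<tau> \<in> C (Suc n) k"
      using iff[of \<sigma> j] mem by (simp add: C_def \<tau>)
  qed
qed

text \<open>Insertion is injective, since \<open>j\<close> is recovered as the image of
  \<open>Suc n\<close>; the two summands are the cases of a new cycle and of an old one.\<close>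

lemma num_cyclic_partitions_Suc:
  assumes E: "\<And>i j. (i, j) \<in> E \<Longrightarrow> j < i"
  shows "num_cyclic_partitions ({1..Suc n}, E) k =
    (if k = 0 then 0 else num_cyclic_partitions ({1..n}, E) (k - 1)) +
    card {j \<in> {1..<Suc n}. (Suc n, j) \<notin> E} * num_cyclic_partitions ({1..n}, E) k"
proof -
  let ?C = "\<lambda>n k. {\<sigma>. cyclic_partition ({1..n}, E) k \<sigma>}"
  let ?ins = "\<lambda>(j, \<sigma>). transpose (Suc n) j \<circ> \<sigma>"
  let ?A = "{Suc n} \<times> (if k = 0 then {} else ?C n (k - 1))"
  let ?B = "{j \<in> {1..<Suc n}. (Suc n, j) \<notin> E} \<times> ?C n k"
  have fin: "finite (?C n k)" for n k
    by (rule finite_subset[OF _ finite_permutations[of "{1..n}"]])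
       (auto simp: cyclic_partition_def)
  have inj: "inj_on ?ins (?A \<union> ?B)"
  proof (rule inj_onI, clarify)
    fix j \<sigma> j' \<sigma>'
    assume mem: "(j, \<sigma>) \<in> ?A \<union> ?B" "(j', \<sigma>') \<in> ?A \<union> ?B"
      and eq: "transpose (Suc n) j \<circ> \<sigma> = transpose (Suc n) j' \<circ> \<sigma>'"
    have perm: "\<sigma> permutes {1..n}" "\<sigma>' permutes {1..n}"
      using mem by (auto simp: cyclic_partition_def split: if_splits)
    have j: "j = j'"
      using eq insert_cycle_apply(1)[OF perm(1) _ refl, of "Suc n" j]
        insert_cycle_apply(1)[OF perm(2) _ refl, of "Suc n" j'] by simp
    have "\<sigma> x = \<sigma>' x" for x
      using fun_cong[OF eq, of x] j by (metis comp_apply transpose_involutory)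
    then show "j = j' \<and> \<sigma> = \<sigma>'" using j by blast
  qed
  have "num_cyclic_partitions ({1..Suc n}, E) k = card (?ins ` (?A \<union> ?B))"
    unfolding num_cyclic_partitions_def by (subst cyclic_partition_Suc[OF E]) simp_all
  also have "\<dots> = card (?A \<union> ?B)"
    using inj by (rule card_image)
  also have "\<dots> = card ?A + card ?B"
    using fin by (intro card_Un_disjoint) auto
  finally show ?thesis
    by (simp add: card_cartesian_product num_cyclic_partitions_def)
qed

text \<open>The recursion in \<open>n\<close> is the rule for the coefficients of a product with
  \<open>x + d\<close>, where \<open>d\<close> is the number of smaller vertices that the new vertex
  may precede.\<close>

theorem num_cyclic_partitions_coeff:
  assumes E: "\<And>i j. (i, j) \<in> E \<Longrightarrow> j < i"
  shows "of_nat (num_cyclic_partitions ({1..n}, E) k) =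
    (coeff (\<Prod>i=1..n. [:of_nat (card {j \<in> {1..<i}. (i, j) \<notin> E}), 1:]) k :: 'a::comm_semiring_1)"
proof (induction n arbitrary: k)
  case 0
  have "{\<sigma>. cyclic_partition ({1..0}, E) k \<sigma>} = (if k = 0 then {id} else {})"
    by (auto simp: cyclic_partition_def)
  then show ?case by (simp add: num_cyclic_partitions_def)
next
  case (Suc n)
  have "coeff ([:b, 1:] * p) k = (if k = 0 then 0 else coeff p (k - 1)) + b * coeff p k"
    for b :: 'a and p
    by (cases k) (auto simp: add.commute)
  then show ?case
    using Suc by (simp add: num_cyclic_partitions_Suc[OF E] mult.commute[of _ "[:_, 1:]"]
      del: mult_pCons_left mult_pCons_right One_nat_def)
qed

section \<open>Dyck paths and the two digraphs\<close>

definition height :: "letter list \<Rightarrow> nat \<Rightarrow> int" where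
  "height w r = int (count_list (take r w) V) - int (count_list (take r w) U)"

lemma height_0 [simp]: "height w 0 = 0"
  by (simp add: height_def)

lemma height_Suc:
  "r < length w \<Longrightarrow> height w (Suc r) = height w r + (if w ! r = V then 1 else - 1)"
  by (cases "w ! r") (simp_all add: height_def take_Suc_conv_app_nth)

lemma height_append:
  "height (u @ v) r = (if r \<le> length u then height u r
     else height u (length u) + height v (r - length u))"
  by (simp add: height_def)

lemma height_Cons: "height (a # w) (Suc r) = (if a = V then 1 else - 1) + height w r"
  by (cases a) (simp_all add: height_def)

lemma dyck_iff_height: "dyck w \<longleftrightarrow> height w (length w) = 0 \<and> (\<forall>r\<le>length w. 0 \<le> height w r)"
  by (auto simp: dyck_def height_def)

lemma dyck_height_nonneg: "dyck w \<Longrightarrow> 0 \<le> height w r"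
  by (cases "r \<le> length w") (auto simp: dyck_iff_height height_def)

lemma dyck_height_U:
  assumes "dyck w" "p < length w" "w ! p = U"
  shows "1 \<le> height w p"
  using dyck_height_nonneg[OF assms(1), of "Suc p"] height_Suc[OF assms(2)] assms(3) by simp

lemma dyck_append: "dyck u \<Longrightarrow> dyck v \<Longrightarrow> dyck (u @ v)"
  by (auto simp: dyck_iff_height height_append)

lemma dyck_wrap:
  assumes "dyck w" shows "dyck (V # w @ [U])"
proof -
  have "height (V # w @ [U]) r \<ge> 0" for r
    using assms dyck_height_nonneg[OF assms]
    by (cases r) (auto simp: height_Cons height_append dyck_iff_height height_def[of "[U]"]
        take_Cons split: nat.splits)
  then show ?thesis
    using assms unfolding dyck_iff_height by (simp add: height_Cons height_append height_def[of "[U]"])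
qed

lemma irreducible_dyck_imp_dyck: "irreducible_dyck w \<Longrightarrow> dyck w"
  using dyck_wrap[of "[]"] by (auto simp: irreducible_dyck_def dyck_wrap) (auto simp: dyck_def)

lemma dyck_concat: "(\<And>v. v \<in> set ws \<Longrightarrow> dyck v) \<Longrightarrow> dyck (concat ws)"
  by (induction ws) (auto intro: dyck_append simp: dyck_def[of "[]"])

text \<open>Cut at the first return to height 0: the piece before it is irreducible, and the rest is
  a shorter Dyck word.\<close>

lemma dyck_decompose:
  "dyck w \<Longrightarrow> \<exists>ws. concat ws = w \<and> (\<forall>v\<in>set ws. irreducible_dyck v)"
proof (induction "length w" arbitrary: w rule: less_induct)
  case less
  show ?case
  proof (cases "w = []")
    case True
    then show ?thesis by (intro exI[of _ "[]"]) simp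
  next
    case False
    let ?P = "\<lambda>r. 0 < r \<and> height w r = 0"
    define r where "r = (LEAST r. ?P r)"
    have "?P (length w)" using False less.prems by (simp add: dyck_iff_height)
    then have r: "?P r" "r \<le> length w" unfolding r_def by (rule LeastI, rule Least_le)
    have pos: "height w s \<ge> 1" if "0 < s" "s < r" for s
      using not_less_Least[of s ?P] that dyck_height_nonneg[OF less.prems, of s]
      by (auto simp: r_def)
    obtain a w1 where w1: "w = a # w1" using False by (cases w) auto
    have "a = V"
      using dyck_height_nonneg[OF less.prems, of 1] w1 height_Cons[of a w1 0] by (cases a) auto
    have "r \<noteq> 1" using r w1 \<open>a = V\<close> height_Cons[of a w1 0] by auto
    \<comment> \<open>The first block is \<open>V\<close>, then \<open>t\<close> letters, then
      \<open>U\<close>; its length \<open>r\<close> is at least 2 because the path is at height 1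
      after the first letter.\<close>
    define t where "t = r - 2"
    have t: "r = Suc (Suc t)" using r(1) \<open>r \<noteq> 1\<close> unfolding t_def by arith
    have tl: "t < length w1" using t r w1 by simp
    \<comment> \<open>A \<open>V\<close> here would mean that height 0 at \<open>r\<close> is
      reached from height -1.\<close>
    have tU: "w1 ! t = U"
    proof (rule ccontr)
      assume "w1 ! t \<noteq> U"
      then have "height w1 (Suc t) = height w1 t + 1"
        using height_Suc[OF tl] by (cases "w1 ! t") auto
      then show False
        using r t w1 dyck_height_nonneg[OF less.prems, of "Suc t"] by (simp add: height_Cons)
    qed
    let ?w' = "take t w1"
    have split: "w = (V # ?w' @ [U]) @ drop (Suc t) w1"
      using w1 \<open>a = V\<close> id_take_nth_drop[OF tl] tU by simp
    have height': "height ?w' s = height w (Suc s) - 1" if "s \<le> t" for s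
      using that tl w1 \<open>a = V\<close> by (simp add: height_Cons) (simp add: height_def min_absorb1)
    have "height ?w' t = 0"
      using height'[of t] r t w1 \<open>a = V\<close> tU height_Suc[OF tl] by (simp add: height_Cons)
    moreover have "0 \<le> height ?w' s" if "s \<le> t" for s
      using height'[OF that] pos[of "Suc s"] that t by simp
    ultimately have "dyck ?w'" using tl by (auto simp: dyck_iff_height)
    then have irr: "irreducible_dyck (V # ?w' @ [U])"
      by (cases "?w' = []") (auto simp: irreducible_dyck_def)
    have drop: "height (drop r w) s = height w (r + s)" for s
      using r height_append[of "take r w" "drop r w" "r + s"]
      by (cases "s = 0") (auto simp: height_def)
    have "dyck (drop r w)"
      using less.prems r unfolding dyck_iff_height by (auto simp: drop)
    moreover have "length (drop r w) < length w" using r by auto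
    ultimately obtain ws where "concat ws = drop r w" "\<forall>v\<in>set ws. irreducible_dyck v"
      using less.hyps by blast
    moreover have "drop r w = drop (Suc t) w1" using t w1 by simp
    ultimately show ?thesis
      using irr split by (intro exI[of _ "(V # ?w' @ [U]) # ws"]) auto
  qed
qed

text \<open>\<open>(p, q) \<in> nested w\<close>: the pair of the \<open>U\<close> at \<open>q\<close> encloses that of the \<open>U\<close> at \<open>p\<close>. The
  \<open>V\<close> matching \<open>q\<close> is before \<open>p\<close> iff the path stays at least as high as before \<open>q\<close>.\<close>

definition nested :: "letter list \<Rightarrow> (nat \<times> nat) set" where
  "nested w = {(p, q). p < q \<and> q < length w \<and> w ! p = U \<and> w ! q = U \<and>
     (\<forall>r. p < r \<and> r \<le> q \<longrightarrow> height w q \<le> height w r)}"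

definition U_positions :: "letter list \<Rightarrow> nat set" where
  "U_positions w = {p. p < length w \<and> w ! p = U}"

definition nest_graph :: "letter list \<Rightarrow> ugraph" where
  "nest_graph w = (U_positions w, (\<lambda>(p, q). {p, q}) ` nested w)"

section \<open>Nesting in concatenated and wrapped words\<close>

lemma U_positions_Nil [simp]: "U_positions [] = {}"
  by (simp add: U_positions_def)

lemma U_positions_Cons:
  "U_positions (a # w) = (if a = U then {0} else {}) \<union> Suc ` U_positions w"
  unfolding U_positions_def
proof (intro set_eqI)
  fix p show "p \<in> {p. p < length (a # w) \<and> (a # w) ! p = U} \<longleftrightarrow>
     p \<in> (if a = U then {0} else {}) \<union> Suc ` {p. p < length w \<and> w ! p = U}"
    by (cases p) auto
qed

lemma U_positions_append:
  "U_positions (u @ v) = U_positions u \<union> (+) (length u) ` U_positions v"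
  by (induction u) (auto simp: U_positions_Cons image_Un image_image)

lemma nested_subset: "nested w \<subseteq> U_positions w \<times> U_positions w"
  by (auto simp: nested_def U_positions_def)

text \<open>Nesting depends only on differences of heights between the two positions, so a factor
  keeps it wherever it starts.\<close>

lemma nested_shift:
  assumes "\<And>r. r \<le> length v \<Longrightarrow> height w (l + r) = c + height v r"
    and "\<And>r. r < length v \<Longrightarrow> w ! (l + r) = v ! r" and "l + length v \<le> length w"
    and "p < length v" "q < length v"
  shows "(l + p, l + q) \<in> nested w \<longleftrightarrow> (p, q) \<in> nested v"
proof -
  have "(\<forall>r. l + p < r \<and> r \<le> l + q \<longrightarrow> height w (l + q) \<le> height w r) \<longleftrightarrow>
        (\<forall>r. p < r \<and> r \<le> q \<longrightarrow> height v q \<le> height v r)"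
  proof (intro iffI allI impI)
    fix r assume *: "\<forall>r. l + p < r \<and> r \<le> l + q \<longrightarrow> height w (l + q) \<le> height w r"
      and r: "p < r \<and> r \<le> q"
    show "height v q \<le> height v r"
      using *[rule_format, of "l + r"] r assms(1)[of r] assms(1)[of q] assms(5) by simp
  next
    fix r assume *: "\<forall>r. p < r \<and> r \<le> q \<longrightarrow> height v q \<le> height v r"
      and r: "l + p < r \<and> r \<le> l + q"
    show "height w (l + q) \<le> height w r"
    proof -
      obtain s where s: "r = l + s" using r le_Suc_ex[of l r] by auto
      then show ?thesis
        using *[rule_format, of s] r assms(1)[of s] assms(1)[of q] assms(5) by simp
    qed
  qed
  then show ?thesis using assms by (simp add: nested_def)
qed

text \<open>No pair encloses a position of the other factor: the path is at height 0 between the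
  factors, while every \<open>U\<close> of \<open>v\<close> starts at height at least 1.\<close>

lemma nested_append:
  assumes "dyck u" "dyck v"
  shows "nested (u @ v) = nested u \<union> map_prod ((+) (length u)) ((+) (length u)) ` nested v"
proof -
  let ?l = "length u"
  have u: "(p, q) \<in> nested (u @ v) \<longleftrightarrow> (p, q) \<in> nested u" if "p < ?l" "q < ?l" for p q
    using nested_shift[of u "u @ v" 0 0 p q] that by (simp add: height_append nth_append)
  have v: "(?l + p, ?l + q) \<in> nested (u @ v) \<longleftrightarrow> (p, q) \<in> nested v"
    if "p < length v" "q < length v" for p q
    using nested_shift[of v "u @ v" ?l 0 p q] that assms
    by (simp add: height_append nth_append dyck_iff_height)
  have across: "(p, ?l + q) \<notin> nested (u @ v)" if "p < ?l" "q < length v" for p q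
  proof
    assume *: "(p, ?l + q) \<in> nested (u @ v)"
    then have "height (u @ v) (?l + q) \<le> height (u @ v) ?l" "v ! q = U"
      using that by (auto simp: nested_def nth_append)
    then show False
      using dyck_height_U[OF assms(2) that(2)] assms(1)
      by (cases "q = 0") (auto simp: height_append dyck_iff_height)
  qed
  show ?thesis
  proof (intro equalityI subrelI)
    fix p q assume *: "(p, q) \<in> nested (u @ v)"
    then have pq: "p < q" "q < ?l + length v" by (auto simp: nested_def)
    consider "q < ?l" | q' where "p < ?l" "q = ?l + q'" "q' < length v"
      | p' q' where "p = ?l + p'" "q = ?l + q'" "p' < length v" "q' < length v"
    proof (cases "q < ?l")
      case False
      then show ?thesis
        using pq that(2)[of "q - ?l"] that(3)[of "p - ?l" "q - ?l"] by (cases "p < ?l") auto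
    qed (use that in blast)
    then show "(p, q) \<in> nested u \<union> map_prod ((+) ?l) ((+) ?l) ` nested v"
    proof cases
      case 1 then show ?thesis using * u[of p q] pq by simp
    next
      case 2 then show ?thesis using * across by blast
    next
      case 3 then show ?thesis using * v[of p' q'] by (auto intro!: image_eqI[of _ _ "(p', q')"])
    qed
  next
    fix p q assume "(p, q) \<in> nested u \<union> map_prod ((+) ?l) ((+) ?l) ` nested v"
    then show "(p, q) \<in> nested (u @ v)"
    proof
      assume *: "(p, q) \<in> nested u"
      then have "p < ?l" "q < ?l" by (auto simp: nested_def)
      then show ?thesis using * u by blast
    next
      assume "(p, q) \<in> map_prod ((+) ?l) ((+) ?l) ` nested v"
      then obtain p' q' where "(p', q') \<in> nested v" "p = ?l + p'" "q = ?l + q'" by auto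
      moreover from this have "p' < length v" "q' < length v" by (auto simp: nested_def)
      ultimately show ?thesis using v by blast
    qed
  qed
qed

text \<open>The inner word is lifted by 1, and the last \<open>U\<close> starts at height 1, the
  least height between the first letter and it, so it encloses every inner \<open>U\<close>.\<close>

lemma nested_wrap:
  assumes "dyck w"
  shows "nested (V # w @ [U]) =
    map_prod Suc Suc ` nested w \<union> (\<lambda>p. (Suc p, Suc (length w))) ` U_positions w"
proof -
  let ?W = "V # w @ [U]"
  have height: "height ?W (Suc r) = 1 + height w r" if "r \<le> length w" for r
    using that by (simp add: height_Cons height_append)
  have inner: "(Suc p, Suc q) \<in> nested ?W \<longleftrightarrow> (p, q) \<in> nested w"
    if "p < length w" "q < length w" for p q
    using nested_shift[of w ?W 1 1 p q] that height by (simp add: nth_append)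
  have outer: "(Suc p, Suc (length w)) \<in> nested ?W \<longleftrightarrow> p \<in> U_positions w" for p
  proof -
    have "height ?W (Suc (length w)) \<le> height ?W r" if "Suc p < r" "r \<le> Suc (length w)" for r
      using that height[of "length w"] height[of "r - 1"] assms dyck_height_nonneg[OF assms, of "r - 1"]
      by (simp add: dyck_iff_height)
    then show ?thesis by (auto simp: nested_def U_positions_def nth_append)
  qed
  show ?thesis
  proof (intro equalityI subrelI)
    fix p q assume *: "(p, q) \<in> nested ?W"
    then have pq: "p < q" "q < length ?W" "?W ! p = U" by (auto simp: nested_def)
    then obtain p' where p': "p = Suc p'" by (cases p) auto
    obtain q' where q': "q = Suc q'" using pq by (cases q) auto
    show "(p, q) \<in> map_prod Suc Suc ` nested w \<union> (\<lambda>p. (Suc p, Suc (length w))) ` U_positions w"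
    proof (cases "q' = length w")
      case True
      then show ?thesis using * outer[of p'] p' q' by simp
    next
      case False
      then have "p' < length w" "q' < length w" using pq p' q' by auto
      then show ?thesis using * inner[of p' q'] p' q' by (auto intro!: image_eqI[of _ _ "(p', q')"])
    qed
  next
    fix p q
    assume "(p, q) \<in> map_prod Suc Suc ` nested w \<union> (\<lambda>p. (Suc p, Suc (length w))) ` U_positions w"
    then show "(p, q) \<in> nested ?W"
    proof
      assume "(p, q) \<in> map_prod Suc Suc ` nested w"
      then obtain p' q' where "(p', q') \<in> nested w" "p = Suc p'" "q = Suc q'" by auto
      moreover from this have "p' < length w" "q' < length w" by (auto simp: nested_def)
      ultimately show ?thesis using inner by blast
    qed (use outer in blast)
  qed
qed

section \<open>The recursive construction of G\<close>

lemma nest_graph_Nil: "nest_graph [] = ({}, {})"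
  by (auto simp: nest_graph_def nested_def)

lemma nest_graph_append:
  assumes "dyck u" "dyck v"
  shows "nest_graph (u @ v) =
    (fst (nest_graph u) \<union> fst (map_graph ((+) (length u)) (nest_graph v)),
     snd (nest_graph u) \<union> snd (map_graph ((+) (length u)) (nest_graph v)))"
  by (simp add: nest_graph_def map_graph_def U_positions_append nested_append[OF assms]
      image_Un image_image case_prod_unfold)

lemma nest_graph_wrap:
  assumes "dyck w"
  shows "nest_graph (V # w @ [U]) = (insert (length w + 1) (fst (map_graph Suc (nest_graph w))),
     snd (map_graph Suc (nest_graph w)) \<union>
     {{x, length w + 1} | x. x \<in> fst (map_graph Suc (nest_graph w))})"
  by (auto simp: nest_graph_def map_graph_def U_positions_append U_positions_Cons
      nested_wrap[OF assms] image_Un image_image case_prod_unfold)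

lemma nest_graph_concat:
  assumes "\<And>v. v \<in> set ws \<Longrightarrow> dyck v"
  defines "shifted \<equiv> \<lambda>ws i. map_graph (\<lambda>p. length (concat (take i ws)) + p) (nest_graph (ws ! i))"
  shows "nest_graph (concat ws) =
    (\<Union>i<length ws. fst (shifted ws i), \<Union>i<length ws. snd (shifted ws i))"
  using assms(1)
proof (induction ws)
  case Nil
  then show ?case by (simp add: nest_graph_Nil)
next
  case (Cons v ws)
  have 0: "shifted (v # ws) 0 = nest_graph v"
    by (simp add: shifted_def map_graph_def)
  have Suc: "shifted (v # ws) (Suc i) = map_graph ((+) (length v)) (shifted ws i)" for i
    by (simp add: shifted_def map_graph_def image_image add.assoc)
  have "nest_graph (concat (v # ws)) =
    (fst (nest_graph v) \<union> fst (map_graph ((+) (length v)) (nest_graph (concat ws))),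
     snd (nest_graph v) \<union> snd (map_graph ((+) (length v)) (nest_graph (concat ws))))"
    using Cons.prems by (simp add: nest_graph_append dyck_concat)
  then show ?case
    using Cons by (simp add: lessThan_Suc_eq_insert_0 0 Suc image_UN map_graph_def)
qed

text \<open>Identifying every result of the construction with the explicit
  \<open>nest_graph w\<close> gives its uniqueness without comparing decompositions of
  \<open>w\<close>.\<close>

lemma builds_G_imp_nest_graph: "builds_G w G \<Longrightarrow> dyck w \<and> G = nest_graph w"
proof (induction rule: builds_G.induct)
  case single
  have "dyck []" by (simp add: dyck_def)
  then show ?case
    using nest_graph_wrap[of "[]"] dyck_wrap[of "[]"] by (simp add: nest_graph_Nil map_graph_def)
next
  case (nest w' G' G'')
  then show ?case by (simp only: nest_graph_wrap dyck_wrap simp_thms)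
next
  case (union ws Gs shifted)
  have dyck: "dyck v" if "v \<in> set ws" for v
    using that union(3) irreducible_dyck_imp_dyck by (metis in_set_conv_nth)
  have "shifted i = map_graph (\<lambda>p. length (concat (take i ws)) + p) (nest_graph (ws ! i))"
    if "i < length ws" for i
    using that union.IH union.hyps by simp
  then show ?case
    using nest_graph_concat[of ws] dyck dyck_concat[of ws] by simp
qed

text \<open>It suffices to build some graph, as the preceding lemma then identifies it.\<close>

lemma builds_G_nest_graph: "dyck w \<Longrightarrow> builds_G w (nest_graph w)"
proof (induction "length w" arbitrary: w rule: less_induct)
  case less
  have "\<exists>G. builds_G w G"
  proof (cases "irreducible_dyck w")
    case True
    then show ?thesis
      unfolding irreducible_dyck_def
    proof (elim disjE exE conjE)
      fix w' assume w': "w' \<noteq> []" "dyck w'" "w = V # w' @ [U]"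
      then have "builds_G w' (nest_graph w')" using less.hyps by simp
      then show ?thesis using builds_G.nest[OF w'(1,2)] w'(3) by blast
    qed (use builds_G.single in blast)
  next
    case False
    obtain ws where ws: "concat ws = w" "\<forall>v\<in>set ws. irreducible_dyck v"
      using dyck_decompose[OF less.prems] by blast
    have "builds_G (ws ! i) (nest_graph (ws ! i))" if i: "i < length ws" for i
    proof (rule less.hyps)
      have irr: "irreducible_dyck (ws ! i)" using ws i by simp
      then show "dyck (ws ! i)" by (rule irreducible_dyck_imp_dyck)
      have w: "w = concat (take i ws) @ ws ! i @ concat (drop (Suc i) ws)"
        using arg_cong[OF id_take_nth_drop[OF i], of concat] ws(1) by simp
      \<comment> \<open>Otherwise nothing would precede or follow this factor, and \<open>w\<close>
        would be irreducible.\<close>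
      show "length (ws ! i) < length w"
      proof (rule ccontr)
        assume "\<not> ?thesis"
        then have "concat (take i ws) = []" "concat (drop (Suc i) ws) = []"
          using arg_cong[OF w, of length] by (simp_all del: concat_eq_Nil_conv)
        then have "w = ws ! i" using w by (simp only: append_Nil append_Nil2)
        then show False using irr False by simp
      qed
    qed
    then have "\<exists>G. builds_G (concat ws) G"
      using ws False
      by - (rule exI, rule builds_G.union[where Gs = "map nest_graph ws" and shifted =
            "\<lambda>i. map_graph (\<lambda>p. length (concat (take i ws)) + p) (map nest_graph ws ! i)"], auto)
    then show ?thesis using ws(1) by simp
  qed
  then show ?case using builds_G_imp_nest_graph by blast
qed

lemma graph_G_eq: "dyck w \<Longrightarrow> graph_G w = map_graph (U_number w) (nest_graph w)"
  unfolding graph_G_def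
  by (subst the_equality[of _ "nest_graph w"])
     (auto intro: builds_G_nest_graph dest: builds_G_imp_nest_graph)

text \<open>The enclosing pairs are told apart by the height of their \<open>U\<close>.\<close>

lemma card_nested:
  assumes w: "dyck w" and p: "p \<in> U_positions w"
  shows "card {q. (p, q) \<in> nested w} = nat (height w (Suc p))"
proof -
  have "bij_betw (height w) {q. (p, q) \<in> nested w} {1..height w (Suc p)}"
  proof (rule bij_betw_imageI)
    \<comment> \<open>The step down at \<open>q\<close> ends one lower and is still at least as high
      as the start of \<open>q'\<close>, so enclosing \<open>U\<close>'s further right start
      strictly lower.\<close>
    have less: "height w q' < height w q" if "(p, q) \<in> nested w" "(p, q') \<in> nested w" "q < q'" for q q'
    proof -
      have "height w q' \<le> height w (Suc q)" using that by (auto simp: nested_def)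
      moreover have "height w (Suc q) = height w q - 1"
        using that height_Suc[of q w] by (auto simp: nested_def)
      ultimately show ?thesis by simp
    qed
    then show "inj_on (height w) {q. (p, q) \<in> nested w}"
      by (intro linorder_inj_onI') fastforce
    show "height w ` {q. (p, q) \<in> nested w} = {1..height w (Suc p)}"
    proof (intro equalityI subsetI)
      fix t assume "t \<in> height w ` {q. (p, q) \<in> nested w}"
      then show "t \<in> {1..height w (Suc p)}"
        using dyck_height_U[OF w] by (auto simp: nested_def)
    next
      fix t assume t: "t \<in> {1..height w (Suc p)}"
      \<comment> \<open>For level \<open>t\<close> the enclosing \<open>U\<close> is the first step
        after \<open>p\<close> that ends below \<open>t\<close>; up to it the path stays at height
        at least \<open>t\<close>.\<close>
      let ?P = "\<lambda>q. p < q \<and> height w (Suc q) < t"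
      define q where "q = (LEAST q. ?P q)"
      have len: "height w (length w) = 0" using w by (simp add: dyck_iff_height)
      \<comment> \<open>Past its end a path keeps its final height 0, so \<open>length w\<close> is
        a candidate for \<open>q\<close>.\<close>
      have "height w (Suc (length w)) = 0" using len by (simp add: height_def)
      then have "?P (length w)" using p t by (simp add: U_positions_def)
      then have q: "?P q" unfolding q_def by (rule LeastI)
      have above: "t \<le> height w r" if r: "p < r" "r \<le> q" for r
      proof (cases "r = Suc p")
        case False
        then obtain s where s: "r = Suc s" "p < s" using r by (cases r) auto
        then show ?thesis using not_less_Least[of s ?P] r by (auto simp: q_def)
      qed (use t in simp)
      have "q < length w"
      proof (rule ccontr)
        assume "\<not> q < length w"
        then have "height w q = 0" using len by (simp add: height_def)
        then show False using above[of q] q t by simp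
      qed
      then have "w ! q = U" "height w q = t"
        using above[of q] q height_Suc[of q w] by (cases "w ! q"; simp)+
      then have "(p, q) \<in> nested w"
        using \<open>q < length w\<close> above q p by (auto simp: nested_def U_positions_def)
      then show "t \<in> height w ` {q. (p, q) \<in> nested w}"
        using \<open>height w q = t\<close> by blast
    qed
  qed
  then show ?thesis using bij_betw_same_card by fastforce
qed

section \<open>Numbers of the U's and vertex degrees\<close>

lemma count_list_drop: "count_list (drop p w) l = count_list w l - count_list (take p w) l"
  using count_list_append[of "take p w" "drop p w" l] by simp

lemma U_number_eq_Suc: "p \<in> U_positions w \<Longrightarrow> U_number w p = Suc (U_number w (Suc p))"
  by (simp add: U_number_def U_positions_def flip: Cons_nth_drop_Suc)

lemma U_number_antimono: "p \<le> q \<Longrightarrow> U_number w q \<le> U_number w p"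
proof -
  assume "p \<le> q"
  then have "drop p w = take (q - p) (drop p w) @ drop q w"
    using append_take_drop_id[of "q - p" "drop p w"] by (simp del: append_take_drop_id)
  from arg_cong[OF this, of "\<lambda>v. count_list v U"] show ?thesis
    unfolding U_number_def count_list_append by linarith
qed

lemma U_number_less: "p \<in> U_positions w \<Longrightarrow> p < q \<Longrightarrow> U_number w q < U_number w p"
  using U_number_eq_Suc[of p w] U_number_antimono[of "Suc p" q w] by simp

lemma inj_on_U_number: "inj_on (U_number w) (U_positions w)"
  by (intro linorder_inj_onI') (metis U_number_less less_irrefl)

lemma U_number_image: "U_number w ` U_positions w = {1..count_list w U}"
proof (induction w)
  case (Cons a w)
  have "U_number (a # w) (Suc p) = U_number w p" for p by (simp add: U_number_def)
  then show ?case
    using Cons by (auto simp: U_positions_Cons image_image U_number_def atLeastAtMostSuc_conv)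
qed simp

lemma semilength_eq: "dyck w \<Longrightarrow> semilength w = count_list w U \<and> semilength w = count_list w V"
proof -
  have "length w = count_list w U + count_list w V"
    by (induction w) (auto, metis letter.exhaust)
  then show "dyck w \<Longrightarrow> ?thesis" by (simp add: semilength_def dyck_def)
qed

text \<open>The path ends at height 0, so its height after \<open>p\<close> is the surplus of
  \<open>U\<close>'s over \<open>V\<close>'s in the rest, which contains
  \<open>U_number w p - 1\<close> \<open>U\<close>'s.\<close>

lemma height_Suc_U_position:
  assumes "dyck w" "p \<in> U_positions w"
  shows "height w (Suc p) = int (U_number w p) - 1 - int (count_list (drop p w) V)"
proof -
  have "w = take (Suc p) w @ drop (Suc p) w" by simp
  then have "count_list w l = count_list (take (Suc p) w) l + count_list (drop (Suc p) w) l" for l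
    by (metis count_list_append)
  moreover have "count_list (drop p w) V = count_list (drop (Suc p) w) V"
    using assms(2) by (simp add: U_positions_def flip: Cons_nth_drop_Suc)
  ultimately show ?thesis
    using assms U_number_eq_Suc[of p w] by (simp add: height_def U_number_def dyck_def)
qed

lemma column_less_U_number:
  assumes "dyck w" "p \<in> U_positions w"
  shows "count_list (drop p w) V < U_number w p"
  using height_Suc_U_position[OF assms] dyck_height_nonneg[OF assms(1), of "Suc p"] by simp

lemma orient_edge_less: "(i, j) \<in> snd (orient G) \<Longrightarrow> j < i"
  by (auto simp: orient_def)

lemma orient_edge_iff: "(i, j) \<in> snd (orient G) \<longleftrightarrow> j < i \<and> {i, j} \<in> snd G"
  by (auto simp: orient_def insert_commute)

text \<open>The smaller neighbours of \<open>i\<close> are the numbers of the enclosing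
  \<open>U\<close>'s, which lie further right. By \<open>card_nested\<close> there are as many as
  the height after \<open>p\<close>, which leaves the number of \<open>V\<close>'s among the
  \<open>i - 1\<close> smaller labels.\<close>

lemma non_neighbours_G:
  assumes w: "dyck w" and p: "p \<in> U_positions w"
  defines "i \<equiv> U_number w p"
  shows "card {j \<in> {1..<i}. (i, j) \<notin> snd (digraph_G w)} = count_list (drop p w) V"
proof -
  let ?N = "U_number w ` {q. (p, q) \<in> nested w}"
  have edges: "(i, j) \<in> snd (digraph_G w) \<longleftrightarrow> j \<in> ?N" for j
  proof
    assume "(i, j) \<in> snd (digraph_G w)"
    then have "j < i" "{i, j} \<in> snd (graph_G w)" by (auto simp: digraph_G_def orient_edge_iff)
    then obtain p' q where q: "(p', q) \<in> nested w" and eq: "{i, j} = {U_number w p', U_number w q}"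
      using w by (auto simp: graph_G_eq map_graph_def nest_graph_def)
    have "p' \<in> U_positions w" "p' < q" using q nested_subset by (auto simp: nested_def)
    then have "U_number w q < U_number w p'" by (rule U_number_less)
    then have ij: "i = U_number w p'" "j = U_number w q"
      using eq \<open>j < i\<close> by (auto simp: doubleton_eq_iff)
    then have "p' = p"
      using inj_onD[OF inj_on_U_number] p \<open>p' \<in> U_positions w\<close> by (auto simp: i_def)
    then show "j \<in> ?N" using ij q by blast
  next
    assume "j \<in> ?N"
    then obtain q where q: "(p, q) \<in> nested w" "j = U_number w q" by blast
    then have "j < i" using U_number_less[OF p, of q] by (auto simp: nested_def i_def)
    moreover have "{i, j} \<in> snd (graph_G w)"
      using q w by (auto simp: graph_G_eq map_graph_def nest_graph_def i_def
          intro!: image_eqI[of _ _ "{p, q}"] image_eqI[of _ _ "(p, q)"])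
    ultimately show "(i, j) \<in> snd (digraph_G w)" by (simp add: digraph_G_def orient_edge_iff)
  qed
  have sub: "?N \<subseteq> {1..<i}"
  proof
    fix j assume j: "j \<in> ?N"
    then have "j < i" using edges orient_edge_less unfolding digraph_G_def by blast
    moreover have "j \<in> U_number w ` U_positions w" using j nested_subset by blast
    ultimately show "j \<in> {1..<i}" by (simp add: U_number_image)
  qed
  have "inj_on (U_number w) {q. (p, q) \<in> nested w}"
    by (rule inj_on_subset[OF inj_on_U_number]) (use nested_subset in blast)
  then have "card ?N = nat (height w (Suc p))"
    by (simp add: card_image card_nested[OF w p])
  moreover have "{j \<in> {1..<i}. (i, j) \<notin> snd (digraph_G w)} = {1..<i} - ?N"
    using edges by blast
  ultimately show ?thesis
    using sub column_less_U_number[OF w p]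
    by (simp add: card_Diff_subset finite_subset[OF sub] height_Suc_U_position[OF w p] i_def)
qed

text \<open>The column label \<open>n - x\<close> of a \<open>U\<close> is its number from the
  right, and the heights from the path up to the top become the row labels from 1 on.\<close>

lemma board_iff:
  assumes w: "dyck w" and p: "p \<in> U_positions w"
  shows "(U_number w p, j) \<in> board w \<longleftrightarrow> j \<in> {1..count_list (drop p w) V}"
proof -
  have n: "semilength w = count_list w U" "semilength w = count_list w V"
    using semilength_eq[OF w] by auto
  have le: "count_list (take p w) l \<le> count_list w l" for p l
    using count_list_append[of "take p w" "drop p w" l] by simp
  have column: "semilength w - count_list (take q w) U = U_number w q" for q
    by (simp add: U_number_def count_list_drop n)
  have "(U_number w p, j) \<in> board w \<longleftrightarrow>
     (\<exists>q y. q \<in> U_positions w \<and> U_number w q = U_number w p \<and> j = semilength w - y \<and>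
        count_list (take q w) V \<le> y \<and> y < semilength w)"
    unfolding board_def U_positions_def by (auto simp: column) (metis column)
  also have "\<dots> \<longleftrightarrow> (\<exists>y. j = semilength w - y \<and> count_list (take p w) V \<le> y \<and> y < semilength w)"
    using p inj_onD[OF inj_on_U_number, of w _ p] by blast
  also have "\<dots> \<longleftrightarrow> j \<in> {1..semilength w - count_list (take p w) V}"
  proof
    assume "j \<in> {1..semilength w - count_list (take p w) V}"
    then show "\<exists>y. j = semilength w - y \<and> count_list (take p w) V \<le> y \<and> y < semilength w"
      by (intro exI[of _ "semilength w - j"]) auto
  qed auto
  finally show ?thesis by (simp add: count_list_drop n(2))
qed

text \<open>The column has fewer than \<open>i\<close> cells by \<open>column_less_U_number\<close>,
  so restricting to \<open>j < i\<close> loses none of them.\<close>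

lemma non_neighbours_H:
  assumes w: "dyck w" and p: "p \<in> U_positions w"
  defines "i \<equiv> U_number w p"
  shows "card {j \<in> {1..<i}. (i, j) \<notin> snd (digraph_H w)} = count_list (drop p w) V"
proof -
  have "i \<in> {1..semilength w}"
    using imageI[OF p, of "U_number w"] semilength_eq[OF w] by (simp add: U_number_image i_def)
  then have "(i, j) \<in> snd (digraph_H w) \<longleftrightarrow> (i, j) \<notin> board w" if "j \<in> {1..<i}" for j
    using that by (fastforce simp: digraph_H_def orient_edge_iff graph_H_def doubleton_eq_iff)
  then have "{j \<in> {1..<i}. (i, j) \<notin> snd (digraph_H w)} = {j \<in> {1..<i}. (i, j) \<in> board w}"
    by blast
  also have "\<dots> = {1..count_list (drop p w) V}"
    using column_less_U_number[OF w p] by (auto simp: board_iff[OF w p] i_def)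
  finally show ?thesis by simp
qed

text \<open>Numbering from the right is stable under prepending a letter: a new \<open>U\<close>
  takes the next label and has all \<open>V\<close>'s of the old word to its right.\<close>

lemma normal_poly_eq_prod:
  assumes "\<And>p. p \<in> U_positions w \<Longrightarrow> f (U_number w p) = count_list (drop p w) V"
  shows "normal_poly w = (\<Prod>i=1..count_list w U. [:of_nat (f i), 1:] :: 'a::comm_semiring_1 poly)"
  using assms
proof (induction w rule: normal_poly.induct)
  case (2 w)
  have "f (U_number w p) = count_list (drop p w) V" if "p \<in> U_positions w" for p
    using 2(2)[of "Suc p"] that by (simp add: U_positions_Cons U_number_def)
  then show ?case using 2 by simp
next
  case (3 w)
  have "f (U_number w p) = count_list (drop p w) V" if "p \<in> U_positions w" for p
    using 3(2)[of "Suc p"] that by (simp add: U_positions_Cons U_number_def)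
  moreover have "f (Suc (count_list w U)) = count_list w V"
    using 3(2)[of 0] by (simp add: U_positions_Cons U_number_def)
  ultimately show ?case
    using 3(1) by (simp add: mult.commute[of _ "[:_, 1:]"] del: mult_pCons_left mult_pCons_right)
qed simp

text \<open>Common criterion for \<open>H\<close> and \<open>G\<close>: if each vertex has as many
  smaller non-neighbours as its \<open>U\<close> has \<open>V\<close>'s to the right, the two
  products have the same factors.\<close>

lemma num_cyclic_partitions_normal_poly:
  assumes "\<And>i j. (i, j) \<in> E \<Longrightarrow> j < i"
    and "\<And>p. p \<in> U_positions w \<Longrightarrow>
      card {j \<in> {1..<U_number w p}. (U_number w p, j) \<notin> E} = count_list (drop p w) V"
  shows "of_nat (num_cyclic_partitions ({1..count_list w U}, E) k) =
    (coeff (normal_poly w) k :: 'a::comm_semiring_1)"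
  by (subst num_cyclic_partitions_coeff[OF assms(1)], assumption)
     (subst normal_poly_eq_prod[of w, OF assms(2)], simp_all)

lemma num_cyclic_partitions_H:
  assumes "dyck w"
  shows "of_nat (num_cyclic_partitions (digraph_H w) k) =
    (coeff (normal_poly w) k :: 'a::comm_semiring_1)"
proof -
  have "digraph_H w = ({1..count_list w U}, snd (digraph_H w))"
    using semilength_eq[OF assms] by (simp add: digraph_H_def orient_def graph_H_def)
  moreover have "j < i" if "(i, j) \<in> snd (digraph_H w)" for i j
    using that orient_edge_less unfolding digraph_H_def by blast
  ultimately show ?thesis
    using num_cyclic_partitions_normal_poly[of "snd (digraph_H w)" w k]
      non_neighbours_H[OF assms] by simp
qed

lemma num_cyclic_partitions_G:
  assumes "dyck w"
  shows "of_nat (num_cyclic_partitions (digraph_G w) k) =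
    (coeff (normal_poly w) k :: 'a::comm_semiring_1)"
proof -
  have "digraph_G w = ({1..count_list w U}, snd (digraph_G w))"
    using U_number_image[of w]
    by (simp add: digraph_G_def orient_def graph_G_eq[OF assms] map_graph_def nest_graph_def)
  moreover have "j < i" if "(i, j) \<in> snd (digraph_G w)" for i j
    using that orient_edge_less unfolding digraph_G_def by blast
  ultimately show ?thesis
    using num_cyclic_partitions_normal_poly[of "snd (digraph_G w)" w k]
      non_neighbours_G[OF assms] by simp
qed

theorem theorem8:
  fixes w :: "letter list" and k :: nat
  assumes "dyck w" and "k \<le> semilength w"
  shows "(normal_coeff w k :: 'a::comm_ring_1) = of_nat (num_cyclic_partitions (digraph_H w) k) \<and>
    num_cyclic_partitions (digraph_H w) k = num_cyclic_partitions (digraph_G w) k"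
  \<comment> \<open>The instances at \<open>nat\<close> give the equality of the two counts
    themselves, since \<open>of_nat\<close> into the coefficient ring may fail to be
    injective.\<close>
  using num_cyclic_partitions_H[OF assms(1), of k, where 'a = 'a]
    num_cyclic_partitions_H[OF assms(1), of k, where 'a = nat]
    num_cyclic_partitions_G[OF assms(1), of k, where 'a = nat]
  by (simp add: normal_coeff_eq)

end
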